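(* Let $f=(f_1,f_2)$ be a pair of polynomials in $\mathbb{C}[x,y]$ such that the affine curves $(f_1)=\{f_1=0\}$ and $(f_2)=\{f_2=0\}$ intersect only at discrete points of $\mathbb{C}^2$. Suppose that: (RC1) for some positive integer $n$, $f_1$ and $f_2$ both have total degree $n$ and the leading (degree $n$) homogeneous part of each is $x^n$; (RC2) all intersection points of $(f_1)$ and $(f_2)$ in $\mathbb{C}^2$ lie on the line $\{y=0\}$. Suppose further that all intersection points of $(f_1)$ and $(f_2)$ in $\mathbb{C}^2$ are normal crossing. Then there exist polynomials $h_1,h_2,k_1,k_2\in\mathbb{C}[x,y]$ and one-variable polynomials $r(x),\lambda(x),\mu(x)\in\mathbb{C}[x]$ such that $$\begin{pmatrix} f_1\\ f_2\end{pmatrix}=\begin{pmatrix} h_1 & -k_2\\ h_2 & k_1\end{pmatrix}\begin{pmatrix} r(x)\\ y\lambda(x)\end{pmatrix},\qquad \det\begin{pmatrix} h_1 & -k_2\\ h_2 & k_1\end{pmatrix}=\mathcal{J}(f),$$ $$r(x)\mu(x)+r'(x)\lambda(x)=1,\qquad \deg\lambda(x)\le\deg r(x).$$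
   Context: $\mathcal{J}(f)=\frac{\partial(f_1,f_2)}{\partial(x,y)}=\frac{\partial f_1}{\partial x}\frac{\partial f_2}{\partial y}-\frac{\partial f_1}{\partial y}\frac{\partial f_2}{\partial x}$ denotes the Jacobian determinant, and $r'=dr/dx$. An intersection point $p$ of $(f_1)$ and $(f_2)$ is normal crossing (transversal) if $\mathcal{J}(f)(p)\neq 0$. *)

theory Defs
  imports "HOL-Analysis.Analysis" "HOL-Computational_Algebra.Computational_Algebra"
begin

text \<open>
  The ring \<open>\<complex>[x,y]\<close> is represented as \<open>(\<complex>[x])[y]\<close>: the inner variable is \<open>x\<close>, the outer
  variable is \<open>y\<close>, and \<open>coeff (coeff f j) i\<close> is the coefficient of \<open>x\<^sup>i y\<^sup>j\<close>.
\<close>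

type_synonym bipoly = "complex poly poly"

definition bicoeff :: "bipoly \<Rightarrow> nat \<Rightarrow> nat \<Rightarrow> complex" where
  "bicoeff f i j = coeff (coeff f j) i"

definition in_x :: "complex poly \<Rightarrow> bipoly" where
  "in_x p = [:p:]"

definition var_y :: bipoly where
  "var_y = [:0, 1:]"

definition eval2 :: "bipoly \<Rightarrow> complex \<Rightarrow> complex \<Rightarrow> complex" where
  "eval2 f a b = poly (poly f [:b:]) a"

definition curve :: "bipoly \<Rightarrow> (complex \<times> complex) set" where
  "curve f = {(a, b). eval2 f a b = 0}"

definition partial_x :: "bipoly \<Rightarrow> bipoly" where
  "partial_x f = map_poly pderiv f"

definition partial_y :: "bipoly \<Rightarrow> bipoly" where
  "partial_y f = pderiv f"

definition jacobian_det :: "bipoly \<Rightarrow> bipoly \<Rightarrow> bipoly" where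
  "jacobian_det f1 f2 = partial_x f1 * partial_y f2 - partial_y f1 * partial_x f2"

text \<open>As for \<^const>\<open>degree\<close>, the total degree of the zero polynomial is 0.\<close>

definition total_degree :: "bipoly \<Rightarrow> nat" where
  "total_degree f = Max (insert 0 {i + j | i j. bicoeff f i j \<noteq> 0})"

definition hom_part :: "nat \<Rightarrow> bipoly \<Rightarrow> bipoly" where
  "hom_part d f = (\<Sum>j\<le>d. monom (monom (bicoeff f (d - j) j) (d - j)) j)"

definition leading_part :: "bipoly \<Rightarrow> bipoly" where
  "leading_part f = hom_part (total_degree f) f"

definition normal_crossing :: "bipoly \<Rightarrow> bipoly \<Rightarrow> complex \<times> complex \<Rightarrow> bool" where
  "normal_crossing f1 f2 p \<longleftrightarrow> eval2 (jacobian_det f1 f2) (fst p) (snd p) \<noteq> 0"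

lemma finite_bicoeff_support: "finite {i + j | i j. bicoeff f i j \<noteq> 0}"
proof -
  have "{(i, j). bicoeff f i j \<noteq> 0} \<subseteq> (\<Union>j\<le>degree f. (\<lambda>i. (i, j)) ` {..degree (coeff f j)})"
  proof
    fix z assume "z \<in> {(i, j). bicoeff f i j \<noteq> 0}"
    then obtain i j where z: "z = (i, j)" and nz: "coeff (coeff f j) i \<noteq> 0"
      by (auto simp: bicoeff_def)
    have "i \<le> degree (coeff f j)" using nz by (rule le_degree)
    moreover have "j \<le> degree f" using nz by (intro le_degree) auto
    ultimately show "z \<in> (\<Union>j\<le>degree f. (\<lambda>i. (i, j)) ` {..degree (coeff f j)})"
      using z by auto
  qed
  then have "finite {(i, j). bicoeff f i j \<noteq> 0}"
    by (rule finite_subset) auto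
  then have "finite ((\<lambda>(i, j). i + j) ` {(i, j). bicoeff f i j \<noteq> 0})"
    by (rule finite_imageI)
  moreover have "(\<lambda>(i, j). i + j) ` {(i, j). bicoeff f i j \<noteq> 0} = {i + j | i j. bicoeff f i j \<noteq> 0}"
    by auto
  ultimately show ?thesis by simp
qed

lemma bicoeff_hom_part: "bicoeff (hom_part d f) i j = (if i + j = d then bicoeff f i j else 0)"
proof -
  have "bicoeff (hom_part d f) i j
      = (\<Sum>k\<le>d. if k = j then (if d - k = i then bicoeff f (d - k) k else 0) else 0)"
    unfolding hom_part_def
    by (auto simp: bicoeff_def coeff_sum intro!: sum.cong)
  also have "\<dots> = (if j \<le> d then (if d - j = i then bicoeff f (d - j) j else 0) else 0)"
    by (subst sum.delta) auto
  finally show ?thesis by auto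
qed

end

theory Submission
  imports Defs "HOL-Computational_Algebra.Field_as_Ring"
begin

text \<open>
  Let \<open>I = (f1, f2)\<close>, let \<open>r\<close> be the gcd of \<open>f1(x,0)\<close> and \<open>f2(x,0)\<close>, and write
  \<open>f\<^sub>i = A\<^sub>i r + y B\<^sub>i\<close>. Modulo \<open>(r, y)\<close> the Jacobian is \<open>(A1 B2 - A2 B1) r'\<close>, so by
  transversality both factors are units modulo \<open>(r, y)\<close>. As all common zeros lie on
  \<open>y = 0\<close>, some power of \<open>y\<close> is in \<open>I\<close>; together with \<open>y (A2 B1 - A1 B2) \<in> I\<close>
  this yields \<open>I = (r, y)\<close>.
  With \<open>r \<mu> + r' \<lambda> = 1\<close>, the matrix with rows \<open>(A\<^sub>i + y \<mu> B\<^sub>i, r' B\<^sub>i)\<close> sends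
  \<open>(r, y \<lambda>)\<close> to \<open>(f1, f2)\<close>, and its determinant agrees with the Jacobian modulo \<open>I\<close>. Adding
  \<open>c\<^sub>i (y \<lambda>, - r)\<close> to its rows changes the determinant by the arbitrary element
  \<open>f2 c1 - f1 c2\<close> of \<open>I\<close>, hence can make it equal to the Jacobian.
\<close>

section \<open>Ideals with two generators\<close>

definition ideal2 :: "'a::comm_ring_1 \<Rightarrow> 'a \<Rightarrow> 'a set" where
  "ideal2 a b = {p * a + q * b | p q. True}"

lemma ideal2I: "x = p * a + q * b \<Longrightarrow> x \<in> ideal2 a b"
  unfolding ideal2_def by blast

lemma ideal2_add: "x \<in> ideal2 a b \<Longrightarrow> y \<in> ideal2 a b \<Longrightarrow> x + y \<in> ideal2 a b"
proof -
  assume "x \<in> ideal2 a b" "y \<in> ideal2 a b"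
  then obtain p q p' q' where "x = p * a + q * b" "y = p' * a + q' * b"
    unfolding ideal2_def by blast
  then have "x + y = (p + p') * a + (q + q') * b" by (simp add: algebra_simps)
  then show ?thesis by (rule ideal2I)
qed

lemma ideal2_mult: "x \<in> ideal2 a b \<Longrightarrow> z * x \<in> ideal2 a b"
proof -
  assume "x \<in> ideal2 a b"
  then obtain p q where "x = p * a + q * b" unfolding ideal2_def by blast
  then have "z * x = (z * p) * a + (z * q) * b" by (simp add: algebra_simps)
  then show ?thesis by (rule ideal2I)
qed

lemma ideal2_diff: "x \<in> ideal2 a b \<Longrightarrow> y \<in> ideal2 a b \<Longrightarrow> x - y \<in> ideal2 a b"
  using ideal2_add[of x a b "(-1) * y"] ideal2_mult[of y a b "-1"] by simp

lemma ideal2_left: "a \<in> ideal2 a b"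
  by (rule ideal2I[of _ 1 _ 0]) simp

lemma ideal2_right: "b \<in> ideal2 a b"
  by (rule ideal2I[of _ 0 _ 1]) simp

lemma ideal2_subset:
  assumes "a \<in> ideal2 c d" "b \<in> ideal2 c d"
  shows "ideal2 a b \<subseteq> ideal2 c d"
  using assms by (auto simp: ideal2_def[of a b] intro!: ideal2_add ideal2_mult)

text \<open>Modulo the ideal, \<open>y\<close> is nilpotent, so \<open>1 + y * e\<close> is a unit
  and can be cancelled. The induction does this by lowering the exponent of \<open>y\<close> one
  step at a time.\<close>

lemma nilpotent_mult_one_plus_in_ideal2:
  assumes "y * (1 + y * e) \<in> ideal2 a b" "y ^ m \<in> ideal2 a b"
  shows "y \<in> ideal2 a b"
proof -
  have "y \<in> ideal2 a b" if "y ^ Suc k \<in> ideal2 a b" for k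
    using that
  proof (induction k)
    case (Suc k)
    have "y ^ Suc k = y ^ k * (y * (1 + y * e)) - e * y ^ Suc (Suc k)"
      by (simp add: algebra_simps)
    also have "\<dots> \<in> ideal2 a b"
      by (intro ideal2_diff ideal2_mult assms(1) Suc.prems)
    finally show ?case by (rule Suc.IH)
  qed simp
  moreover have "y ^ Suc m \<in> ideal2 a b"
    using ideal2_mult[OF assms(2), of y] by simp
  ultimately show ?thesis by blast
qed

text \<open>Eliminating \<open>r\<close> from \<open>f1\<close> and \<open>f2\<close> puts
  \<open>y * (A1 * B2 - A2 * B1)\<close> into the ideal, and \<open>P\<close> inverts the second
  factor modulo \<open>(r, y)\<close>. By \<open>uv\<close>, \<open>r\<close> is congruent to
  \<open>- y * W\<close> modulo the ideal; substituting this in \<open>D\<close> leaves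
  \<open>y * (1 + y * e)\<close>, where nilpotency of \<open>y\<close> applies.\<close>

lemma generators_in_ideal2:
  fixes r y :: "'a::comm_ring_1"
  assumes f: "f1 = A1 * r + y * B1" "f2 = A2 * r + y * B2"
    and uv: "u * A1 + v * A2 = 1"
    and D: "P * (A1 * B2 - A2 * B1) = 1 - Q * r + y * E"
    and y: "y ^ m \<in> ideal2 f1 f2"
  shows "y \<in> ideal2 f1 f2" "r \<in> ideal2 f1 f2"
proof -
  define W where "W = u * B1 + v * B2"
  have rW: "r + y * W \<in> ideal2 f1 f2"
  proof (rule ideal2I)
    have "r + y * W = (u * A1 + v * A2) * r + y * W" by (simp add: uv)
    then show "r + y * W = u * f1 + v * f2" by (simp add: f W_def algebra_simps)
  qed
  have "A1 * f2 - A2 * f1 \<in> ideal2 f1 f2"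
    by (intro ideal2_diff ideal2_mult ideal2_left ideal2_right)
  then have "P * (A1 * f2 - A2 * f1) + (Q * y) * (r + y * W) \<in> ideal2 f1 f2"
    using rW by (metis ideal2_add ideal2_mult)
  moreover have "P * (A1 * f2 - A2 * f1) = y * (P * (A1 * B2 - A2 * B1))"
    by (simp add: f algebra_simps)
  moreover have "y * (1 - Q * r + y * E) + (Q * y) * (r + y * W) = y * (1 + y * (E + Q * W))"
    by (simp add: algebra_simps)
  ultimately have "y * (1 + y * (E + Q * W)) \<in> ideal2 f1 f2"
    by (simp only: D)
  then show yI: "y \<in> ideal2 f1 f2"
    using y by (rule nilpotent_mult_one_plus_in_ideal2)
  have "(r + y * W) - W * y \<in> ideal2 f1 f2"
    by (intro ideal2_diff ideal2_mult rW yI)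
  then show "r \<in> ideal2 f1 f2" by (simp add: algebra_simps)
qed

section \<open>Evaluation, embeddings and specialisation of \<open>x\<close>\<close>

lemma eval2_simps [simp]:
  "eval2 (p + q) a b = eval2 p a b + eval2 q a b"
  "eval2 (p - q) a b = eval2 p a b - eval2 q a b"
  "eval2 (p * q) a b = eval2 p a b * eval2 q a b"
  "eval2 (in_x u) a b = poly u a"
  "eval2 var_y a b = b"
  by (simp_all add: eval2_def in_x_def var_y_def)

lemma eval2_ideal2: "g \<in> ideal2 f1 f2 \<Longrightarrow> eval2 f1 a b = 0 \<Longrightarrow> eval2 f2 a b = 0 \<Longrightarrow> eval2 g a b = 0"
  by (auto simp: ideal2_def)

lemma in_x_simps:
  "in_x (p + q) = in_x p + in_x q" "in_x (p * q) = in_x p * in_x q" "in_x 1 = 1"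
  by (simp_all add: in_x_def)

lemma bipoly_split_y: "f = in_x (coeff f 0) + var_y * (poly_shift 1 f)"
  by (simp add: in_x_def var_y_def poly_eq_iff coeff_pCons coeff_poly_shift split: nat.split)

definition specialise_x :: "complex \<Rightarrow> bipoly \<Rightarrow> complex poly" where
  "specialise_x a f = map_poly (\<lambda>p. poly p a) f"

definition in_y :: "complex poly \<Rightarrow> bipoly" where
  "in_y u = map_poly (\<lambda>c. [:c:]) u"

lemma specialise_x_pCons: "specialise_x a (pCons p f) = pCons (poly p a) (specialise_x a f)"
  by (simp add: specialise_x_def map_poly_pCons)

lemma poly_specialise_x: "poly (specialise_x a f) b = eval2 f a b"
  by (induction f) (simp_all add: specialise_x_pCons, simp_all add: specialise_x_def eval2_def)

lemma in_y_0 [simp]: "in_y 0 = 0"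
  by (simp add: in_y_def)

lemma in_y_pCons: "in_y (pCons c u) = pCons [:c:] (in_y u)"
  by (simp add: in_y_def map_poly_pCons)

lemma in_y_add: "in_y (u + v) = in_y u + in_y v"
  by (simp add: in_y_def poly_eq_iff coeff_map_poly)

lemma in_y_smult: "in_y (smult c u) = [:[:c:]:] * in_y u"
  by (simp add: in_y_def poly_eq_iff coeff_map_poly mult.commute)

lemma in_y_mult: "in_y (u * v) = in_y u * in_y v"
  by (induction u) (simp_all add: in_y_pCons in_y_add in_y_smult)

lemma in_y_power_var: "in_y ([:0, 1:] ^ k) = var_y ^ k"
proof (induction k)
  case 0
  show ?case by (simp add: in_y_def)
next
  case (Suc k)
  have "in_y [:0, 1:] = var_y" by (simp add: in_y_pCons var_y_def one_pCons)
  then show ?case unfolding power_Suc in_y_mult Suc.IH by simp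
qed

text \<open>Each coefficient \<open>p\<close> differs from its value \<open>poly p a\<close> by a
  multiple of \<open>x - a\<close>. Identities in \<open>y\<close> alone, found after setting
  \<open>x = a\<close>, thus lift to congruences modulo \<open>x - a\<close>.\<close>

lemma specialise_x_cong: "\<exists>q. in_y (specialise_x a f) = f + in_x [:- a, 1:] * q"
proof (induction f)
  case 0
  show ?case by (rule exI[of _ 0]) (simp add: specialise_x_def)
next
  case (pCons p f)
  then obtain q where q: "in_y (specialise_x a f) = f + in_x [:- a, 1:] * q" by blast
  define L where "L = [:- a, 1:]"
  have "L dvd [:poly p a:] - p"
    by (simp add: L_def poly_eq_0_iff_dvd[symmetric])
  then obtain s where "[:poly p a:] - p = L * s" by (elim dvdE)
  then have "[:poly p a:] = p + L * s" by (simp only: diff_eq_eq add.commute)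
  then show ?case
    by (intro exI[of _ "pCons s q"])
      (simp add: specialise_x_pCons in_y_pCons q in_x_def flip: L_def)
qed

section \<open>Derivatives and the Jacobian modulo \<open>(r, y)\<close>\<close>

lemma partial_x_add: "partial_x (f + g) = partial_x f + partial_x g"
  by (simp add: partial_x_def poly_eq_iff coeff_map_poly pderiv_add)

lemma partial_x_mult: "partial_x (f * g) = partial_x f * g + f * partial_x g"
proof -
  have pC: "partial_x (pCons c p) = pCons (pderiv c) (partial_x p)" for c p
    by (simp add: partial_x_def map_poly_pCons)
  have sm: "partial_x (smult c p) = smult (pderiv c) p + smult c (partial_x p)" for c p
    by (simp add: partial_x_def poly_eq_iff coeff_map_poly pderiv_mult algebra_simps)
  show ?thesis
  proof (induction f)
    case 0
    show ?case by (simp add: partial_x_def)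
  next
    case (pCons c f)
    then show ?case by (simp add: partial_x_add pC sm algebra_simps)
  qed
qed

text \<open>In the product rule only the terms that differentiate \<open>r\<close> or
  \<open>y\<close> itself survive modulo \<open>(r, y)\<close>: the partial derivatives of
  \<open>f1\<close> reduce to \<open>A1 * r'\<close> and \<open>B1\<close>, and likewise for
  \<open>f2\<close>.\<close>

lemma jacobian_det_mod:
  assumes f: "f1 = A1 * in_x r + var_y * B1" "f2 = A2 * in_x r + var_y * B2"
  shows "jacobian_det f1 f2 - (A1 * B2 - A2 * B1) * in_x (pderiv r) \<in> ideal2 (in_x r) var_y"
proof -
  have [simp]: "partial_x (in_x r) = in_x (pderiv r)" "partial_y (in_x r) = 0"
    "partial_x var_y = 0" "partial_y var_y = 1"
    by (simp_all add: partial_x_def partial_y_def in_x_def var_y_def map_poly_pCons pderiv_pCons one_pCons)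
  have y: "partial_y (p + q) = partial_y p + partial_y q"
    "partial_y (p * q) = partial_y p * q + p * partial_y q" for p q
    by (simp_all add: partial_y_def pderiv_add pderiv_mult algebra_simps)
  have px: "partial_x (A * in_x r + var_y * B) =
      A * in_x (pderiv r) + (in_x r * partial_x A + var_y * partial_x B)" for A B
    by (simp add: partial_x_add partial_x_mult algebra_simps)
  have py: "partial_y (A * in_x r + var_y * B) =
      B + (in_x r * partial_y A + var_y * partial_y B)" for A B
    by (simp add: y algebra_simps)
  let ?I = "ideal2 (in_x r) var_y"
  have mem: "in_x r * p + var_y * q \<in> ?I" for p q
    by (rule ideal2I[of _ p _ q]) (simp add: mult.commute)
  have gen: "(a1 * s + x1) * (b2 + y2) - (b1 + y1) * (a2 * s + x2) - (a1 * b2 - a2 * b1) * s \<in> ?I"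
    if "x1 \<in> ?I" "x2 \<in> ?I" "y1 \<in> ?I" "y2 \<in> ?I" for a1 a2 b1 b2 s x1 x2 y1 y2
  proof -
    have "(a1 * s + x1) * (b2 + y2) - (b1 + y1) * (a2 * s + x2) - (a1 * b2 - a2 * b1) * s
      = (a1 * s * y2 + (b2 + y2) * x1) - (b1 * x2 + (a2 * s + x2) * y1)"
      by (simp add: algebra_simps)
    also have "\<dots> \<in> ?I"
      by (intro ideal2_diff ideal2_add ideal2_mult that)
    finally show ?thesis .
  qed
  show ?thesis
    unfolding jacobian_det_def f px py by (intro gen mem)
qed

section \<open>Bezout identities and a power of \<open>y\<close> in the ideal\<close>

lemma bezout_no_common_root:
  fixes p q :: "complex poly"
  assumes "\<And>a. poly p a = 0 \<Longrightarrow> poly q a \<noteq> 0"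
  obtains s t where "s * p + t * q = 1"
proof -
  have "gcd p q dvd 1"
  proof (rule ccontr)
    assume n: "\<not> gcd p q dvd 1"
    have "\<exists>a. poly (gcd p q) a = 0"
    proof (cases "gcd p q = 0")
      case False
      then have "degree (gcd p q) \<noteq> 0" using n is_unit_iff_degree[OF False] by blast
      then show ?thesis by (simp add: fundamental_theorem_of_algebra constant_degree)
    qed simp
    then obtain a where "poly (gcd p q) a = 0" ..
    then have "poly p a = 0" "poly q a = 0"
      by (metis dvd_trans gcd_dvd1 gcd_dvd2 poly_eq_0_iff_dvd)+
    then show False using assms by blast
  qed
  then have "gcd p q = 1" by simp
  then show thesis
    using that[of "fst (bezout_coefficients p q)" "snd (bezout_coefficients p q)"]
    by (simp add: bezout_coefficients_fst_snd)
qed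

text \<open>A nonzero element \<open>d\<close> of least degree in \<open>y\<close> is, up to powers
  of its leading coefficient, a common divisor of the ideal. If \<open>d\<close> involved
  \<open>y\<close>, its zeros would give common zeros of \<open>f1\<close> and \<open>f2\<close>
  over almost every \<open>a\<close>, contradicting that they lie over the roots of
  \<open>s\<close>.\<close>

lemma ideal2_meets_x_polys:
  assumes r: "s \<noteq> 0"
    and zeros: "curve f1 \<inter> curve f2 \<subseteq> {(a, b). poly s a = 0}"
  obtains g where "g \<noteq> 0" "in_x g \<in> ideal2 f1 f2"
proof -
  let ?I = "ideal2 f1 f2"
  have ne: "\<exists>d. d \<in> ?I \<and> d \<noteq> 0"
  proof (rule ccontr)
    assume "\<not> ?thesis"
    then have "f1 = 0" "f2 = 0" using ideal2_left ideal2_right by blast+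
    then have "poly s a = 0" for a
      using zeros by (auto simp: curve_def eval2_def)
    then show False using r poly_all_0_iff_0 by blast
  qed
  define d where "d = arg_min degree (\<lambda>d. d \<in> ?I \<and> d \<noteq> 0)"
  have d: "d \<in> ?I" "d \<noteq> 0"
    using arg_min_natI[of "\<lambda>d. d \<in> ?I \<and> d \<noteq> 0" _ degree] ne unfolding d_def by blast+
  have min: "degree d \<le> degree e" if "e \<in> ?I" "e \<noteq> 0" for e
    using arg_min_nat_le[of "\<lambda>d. d \<in> ?I \<and> d \<noteq> 0" e degree] that unfolding d_def by blast
  define l where "l = lead_coeff d"
  have l: "l \<noteq> 0" using d by (simp add: l_def)
  show thesis
  proof (cases "degree d = 0")
    case True
    then obtain g where "d = [:g:]" using degree_eq_zeroE by blast
    then show thesis using d that[of g] by (simp add: in_x_def)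
  next
    case False
    have div: "\<exists>k q. smult (l ^ k) f = d * q" if f: "f \<in> ?I" for f
    proof -
      obtain q t where qt: "pseudo_divmod f d = (q, t)" by fastforce
      let ?k = "Suc (degree f) - degree d"
      \<comment> \<open>The pseudo-remainder \<open>t\<close> lies in the ideal and has smaller
        degree than \<open>d\<close>, so minimality makes it vanish.\<close>
      have e: "smult (l ^ ?k) f = d * q + t" and "t = 0 \<or> degree t < degree d"
        using pseudo_divmod[OF d(2) qt] by (simp_all add: l_def)
      moreover have "t \<in> ?I"
      proof -
        have "t = [:l ^ ?k:] * f - q * d" using e by (simp add: algebra_simps)
        then show ?thesis using f d by (simp add: ideal2_diff ideal2_mult del: mult_pCons_left)
      qed
      ultimately have "t = 0" using min by fastforce
      then show ?thesis using e by auto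
    qed
    from l r have "l * s \<noteq> 0" by simp
    then obtain a where "poly (l * s) a \<noteq> 0" using poly_all_0_iff_0 by blast
    then have la: "poly l a \<noteq> 0" and sa: "poly s a \<noteq> 0" by simp_all
    \<comment> \<open>Since \<open>l\<close> does not vanish at \<open>a\<close>, setting
      \<open>x = a\<close> keeps the positive degree of \<open>d\<close>, and a root
      \<open>b\<close> exists.\<close>
    have "degree (specialise_x a d) = degree d"
      unfolding specialise_x_def using la by (intro map_poly_degree_eq) (simp add: l_def)
    then obtain b where "poly (specialise_x a d) b = 0"
      using False by (metis fundamental_theorem_of_algebra constant_degree)
    then have db: "eval2 d a b = 0" by (simp add: poly_specialise_x)
    have "eval2 f a b = 0" if f: "f \<in> ?I" for f
    proof -
      obtain k q where "smult (l ^ k) f = d * q" using div[OF f] by blast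
      then have "in_x (l ^ k) * f = d * q" by (simp add: in_x_def)
      then have "poly l a ^ k * eval2 f a b = 0"
        using db by (metis eval2_simps(3,4) mult_zero_left poly_power)
      then show ?thesis using la by simp
    qed
    then have "poly s a = 0"
      using zeros ideal2_left[of f1 f2] ideal2_right[of f2 f1] by (auto simp: curve_def)
    then show thesis using sa by simp
  qed
qed

text \<open>On the line \<open>x = a\<close> the only possible common root is \<open>y = 0\<close>,
  so the gcd of the two restrictions divides a power of \<open>y\<close>. Its Bezout identity is
  then lifted modulo \<open>x - a\<close>.\<close>

lemma power_var_y_in_ideal2_mod_linear:
  assumes zeros: "curve f1 \<inter> curve f2 \<subseteq> {(a, b). b = 0}"
  shows "\<exists>k h. var_y ^ k - in_x [:- a, 1:] * h \<in> ideal2 f1 f2"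
proof -
  let ?u = "specialise_x a f1" and ?v = "specialise_x a f2"
  define d where "d = gcd ?u ?v"
  have "d dvd [:0, 1:] ^ degree d"
  proof -
    have root: "b = 0" if "poly d b = 0" for b
    proof -
      have "[:- b, 1:] dvd d" using that by (simp add: poly_eq_0_iff_dvd)
      then have "[:- b, 1:] dvd ?u" "[:- b, 1:] dvd ?v" unfolding d_def by simp_all
      then have "eval2 f1 a b = 0" "eval2 f2 a b = 0"
        by (simp_all add: poly_eq_0_iff_dvd[symmetric] poly_specialise_x)
      then show ?thesis using zeros by (auto simp: curve_def)
    qed
    then have "d \<noteq> 0" using root[of 1] by auto
    then show ?thesis using root nullstellensatz_univariate[of d "[:0, 1:]"] by auto
  qed
  then obtain k where "d dvd [:0, 1:] ^ k" ..
  then obtain w where w: "[:0, 1:] ^ k = d * w" by (elim dvdE)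
  obtain p q where d: "d = p * ?u + q * ?v"
    unfolding d_def using bezout_coefficients_fst_snd by metis
  then have "[:0, 1:] ^ k = (w * p) * ?u + (w * q) * ?v"
    unfolding w d by (simp only: algebra_simps)
  then have k: "var_y ^ k = in_y (w * p) * in_y ?u + in_y (w * q) * in_y ?v"
    by (metis in_y_power_var in_y_mult in_y_add)
  obtain h1 h2 where "in_y ?u = f1 + in_x [:- a, 1:] * h1" "in_y ?v = f2 + in_x [:- a, 1:] * h2"
    using specialise_x_cong by blast
  then have "var_y ^ k - in_x [:- a, 1:] * (in_y (w * p) * h1 + in_y (w * q) * h2)
      = in_y (w * p) * f1 + in_y (w * q) * f2"
    by (simp add: k algebra_simps)
  then show ?thesis using ideal2I by blast
qed

text \<open>Induction over the linear factors of \<open>g\<close>: the congruences for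
  \<open>g'\<close> and for \<open>x - a\<close> are multiplied. For constant \<open>g\<close> the
  exponent 0 suffices, as \<open>g\<close> is a unit.\<close>

lemma power_var_y_in_ideal2_mod:
  assumes zeros: "curve f1 \<inter> curve f2 \<subseteq> {(a, b). b = 0}"
    and "g \<noteq> 0"
  shows "\<exists>k h. var_y ^ k - in_x g * h \<in> ideal2 f1 f2"
  using \<open>g \<noteq> 0\<close>
proof (induction "degree g" arbitrary: g)
  case 0
  then obtain c where g: "g = [:c:]" "c \<noteq> 0"
    by (metis degree_eq_zeroE pCons_0_0)
  then have "in_x g * in_x [:1 / c:] = 1" by (simp add: in_x_def one_pCons)
  then have "var_y ^ 0 - in_x g * in_x [:1 / c:] = 0 * f1 + 0 * f2" by simp
  then show ?case using ideal2I by blast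
next
  case (Suc n)
  then obtain a where "poly g a = 0"
    by (metis fundamental_theorem_of_algebra constant_degree nat.distinct(1))
  then obtain g' where g: "g = [:- a, 1:] * g'" by (metis poly_eq_0_iff_dvd dvdE)
  then have g': "g' \<noteq> 0" using Suc by auto
  then have "degree g = Suc (degree g')" unfolding g by (subst degree_mult_eq) auto
  then obtain k h where kh: "var_y ^ k - in_x g' * h \<in> ideal2 f1 f2"
    using Suc.hyps(1)[OF _ g'] Suc.hyps(2) by auto
  obtain k' h' where kh': "var_y ^ k' - in_x [:- a, 1:] * h' \<in> ideal2 f1 f2"
    using power_var_y_in_ideal2_mod_linear[OF zeros] by blast
  have "var_y ^ (k + k') - in_x g * (h * h') =
    var_y ^ k' * (var_y ^ k - in_x g' * h) + in_x g' * h * (var_y ^ k' - in_x [:- a, 1:] * h')"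
    unfolding g in_x_simps by (simp only: power_add algebra_simps)
  also have "\<dots> \<in> ideal2 f1 f2" by (intro ideal2_add ideal2_mult kh kh')
  finally show ?case by blast
qed

lemma power_var_y_in_ideal2:
  assumes "s \<noteq> 0" "curve f1 \<inter> curve f2 \<subseteq> {(a, b). poly s a = 0}"
    and zeros: "curve f1 \<inter> curve f2 \<subseteq> {(a, b). b = 0}"
  obtains m where "var_y ^ m \<in> ideal2 f1 f2"
proof -
  obtain g where g: "g \<noteq> 0" "in_x g \<in> ideal2 f1 f2"
    using ideal2_meets_x_polys[OF assms(1,2)] by blast
  obtain k h where "var_y ^ k - in_x g * h \<in> ideal2 f1 f2"
    using power_var_y_in_ideal2_mod[OF zeros g(1)] by blast
  \<comment> \<open>As \<open>g\<close> itself lies in the ideal, the congruence modulo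
    \<open>g\<close> becomes membership.\<close>
  then have "(var_y ^ k - in_x g * h) + h * in_x g \<in> ideal2 f1 f2"
    using g by (intro ideal2_add ideal2_mult)
  then show thesis using that by (simp add: mult.commute)
qed

section \<open>Adjusting the determinant to the Jacobian\<close>

lemma correct_determinant:
  fixes f1 f2 r y :: "'a::comm_ring_1"
  assumes f: "f1 = A1 * r + y * B1" "f2 = A2 * r + y * B2"
    and bez: "r * \<mu> + r' * l = 1"
    and J: "J - (A1 * B2 - A2 * B1) * r' \<in> ideal2 f1 f2"
  obtains h1 h2 k1 k2 where "f1 = h1 * r - k2 * (y * l)" "f2 = h2 * r + k1 * (y * l)"
    "h1 * k1 + k2 * h2 = J"
proof -
  obtain p q where pq: "J - (A1 * B2 - A2 * B1) * r' = p * f1 + q * f2"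
    using J unfolding ideal2_def by blast
  \<comment> \<open>The pair \<open>(h A B c, k B c)\<close> is a matrix row; its
    \<open>c\<close>-part \<open>(y * l, - r)\<close> annihilates the vector
    \<open>(r, y * l)\<close>, so \<open>c\<close> remains free.\<close>
  define h where "h A B c = A + y * \<mu> * B + c * y * l" for A B c
  define k where "k B c = r' * B - c * r" for B c
  have row: "h A B c * r + k B c * (y * l) = A * r + y * B" for A B c
  proof -
    have "h A B c * r + k B c * (y * l) = A * r + y * B * (r * \<mu> + r' * l)"
      by (simp add: h_def k_def algebra_simps)
    then show ?thesis by (simp add: bez)
  qed
  show thesis
  \<comment> \<open>For \<open>c = 0\<close> in both rows the determinant is
    \<open>(A1 * B2 - A2 * B1) * r'\<close>. The choices \<open>q\<close> and \<open>- p\<close> add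
    \<open>q * f2 + p * f1\<close>, exactly the missing difference.\<close>
  proof (rule that[of "h A1 B1 q" "- k B1 q" "h A2 B2 (- p)" "k B2 (- p)"])
    show "f1 = h A1 B1 q * r - - k B1 q * (y * l)" "f2 = h A2 B2 (- p) * r + k B2 (- p) * (y * l)"
      using row[of A1 B1 q] row[of A2 B2 "- p"] by (simp_all add: f)
    have "h A1 B1 q * k B2 (- p) + - k B1 q * h A2 B2 (- p) =
      (A1 * B2 - A2 * B1) * r' + p * (A1 * r + y * B1 * (r * \<mu> + r' * l))
        + q * (A2 * r + y * B2 * (r * \<mu> + r' * l))"
      by (simp add: h_def k_def algebra_simps)
    also have "\<dots> = J" using pq unfolding bez by (simp add: f algebra_simps)
    finally show "h A1 B1 q * k B2 (- p) + - k B1 q * h A2 B2 (- p) = J" .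
  qed
qed

theorem theorem1p2:
  fixes f1 f2 :: bipoly and n :: nat
  assumes discrete_intersection: "discrete (curve f1 \<inter> curve f2)"
    and "n > 0"
    and RC1_degree: "total_degree f1 = n" "total_degree f2 = n"
    and RC1_leading: "leading_part f1 = in_x (monom 1 n)" "leading_part f2 = in_x (monom 1 n)"
    and RC2: "curve f1 \<inter> curve f2 \<subseteq> {(a, b). b = 0}"
    and transversal: "\<forall>p \<in> curve f1 \<inter> curve f2. normal_crossing f1 f2 p"
  shows "\<exists>(h1 :: bipoly) (h2 :: bipoly) (k1 :: bipoly) (k2 :: bipoly)
           (r :: complex poly) (lam :: complex poly) (mu :: complex poly).
      (vector [f1, f2] :: bipoly^2) =
        (vector [vector [h1, - k2], vector [h2, k1]] :: bipoly^2^2) *v vector [in_x r, var_y * in_x lam] \<and>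
      det (vector [vector [h1, - k2], vector [h2, k1]] :: bipoly^2^2) = jacobian_det f1 f2 \<and>
      r * mu + pderiv r * lam = 1 \<and>
      degree lam \<le> degree r"
proof -
  have Jnz: "eval2 (jacobian_det f1 f2) a b \<noteq> 0" if "eval2 f1 a b = 0" "eval2 f2 a b = 0" for a b
    using transversal[unfolded normal_crossing_def] that by (force simp: curve_def)
  define p1 p2 where "p1 = coeff f1 0" and "p2 = coeff f2 0"
  define r where "r = gcd p1 p2"
  obtain a1 where a1: "p1 = a1 * r" unfolding r_def by (metis gcd_dvd1 dvdE mult.commute)
  obtain a2 where a2: "p2 = a2 * r" unfolding r_def by (metis gcd_dvd2 dvdE mult.commute)
  obtain u v where uv: "u * p1 + v * p2 = r"
    unfolding r_def using bezout_coefficients_fst_snd by blast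
  define B1 B2 where "B1 = poly_shift 1 f1" and "B2 = poly_shift 1 f2"
  have f: "f1 = in_x a1 * in_x r + var_y * B1" "f2 = in_x a2 * in_x r + var_y * B2"
    using bipoly_split_y[of f1] bipoly_split_y[of f2] a1 a2
    by (simp_all add: B1_def B2_def p1_def p2_def in_x_simps)
  define D where "D = in_x a1 * B2 - in_x a2 * B1"
  have Jmod: "jacobian_det f1 f2 - D * in_x (pderiv r) \<in> ideal2 (in_x r) var_y"
    unfolding D_def by (rule jacobian_det_mod[OF f])
  have fr: "eval2 f1 a 0 = 0" "eval2 f2 a 0 = 0" if "poly r a = 0" for a
    using that by (simp_all add: f)
  \<comment> \<open>A root \<open>a\<close> of \<open>r\<close> gives the common zero
    \<open>(a, 0)\<close>, where the Jacobian is nonzero and equals \<open>D * r'\<close>.\<close>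
  have DJ: "eval2 D a 0 * poly (pderiv r) a \<noteq> 0" if "poly r a = 0" for a
    using eval2_ideal2[OF Jmod, of a 0] that Jnz[OF fr[OF that]] by simp
  \<comment> \<open>If \<open>r\<close> were 0, every \<open>a\<close> would be a root while
    \<open>pderiv r\<close> vanished.\<close>
  have r0: "r \<noteq> 0" using DJ by fastforce
  have rz: "curve f1 \<inter> curve f2 \<subseteq> {(a, b). poly r a = 0}"
  proof clarify
    fix a b assume ab: "(a, b) \<in> curve f1" "(a, b) \<in> curve f2"
    then have "b = 0" using RC2 by auto
    then have "poly p1 a = 0" "poly p2 a = 0" using ab by (simp_all add: curve_def f a1 a2)
    then show "poly r a = 0" unfolding uv[symmetric] by simp
  qed
  obtain m where m: "var_y ^ m \<in> ideal2 f1 f2"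
    using power_var_y_in_ideal2[OF r0 rz RC2] by blast
  have "(u * a1 + v * a2) * r = 1 * r" using uv a1 a2 by (simp add: algebra_simps)
  then have "u * a1 + v * a2 = 1" using r0 by (metis mult_cancel_right)
  then have uv': "in_x u * in_x a1 + in_x v * in_x a2 = 1" by (metis in_x_simps)
  \<comment> \<open>\<open>coeff D 0\<close> is \<open>D\<close> restricted to \<open>y = 0\<close>;
    being coprime to \<open>r\<close>, it has an inverse \<open>P\<close> modulo \<open>r\<close>,
    which inverts \<open>D\<close> modulo \<open>(r, y)\<close>.\<close>
  have "poly (coeff D 0) a = eval2 D a 0" for a
    by (simp add: eval2_def poly_0_coeff_0)
  then have "poly (coeff D 0) a \<noteq> 0" if "poly r a = 0" for a
    using DJ[OF that] by simp
  then obtain Q P where "Q * r + P * coeff D 0 = 1"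
    using bezout_no_common_root by blast
  then have "in_x Q * in_x r + in_x P * in_x (coeff D 0) = 1" by (metis in_x_simps)
  then have PD: "in_x P * D = 1 - in_x Q * in_x r + var_y * (in_x P * poly_shift 1 D)"
    by (subst bipoly_split_y[of D]) (simp add: algebra_simps)
  have "var_y \<in> ideal2 f1 f2" "in_x r \<in> ideal2 f1 f2"
    using generators_in_ideal2[OF f uv' PD[unfolded D_def] m] by blast+
  \<comment> \<open>The congruence modulo \<open>(r, y)\<close> passes to \<open>(f1, f2)\<close>,
    the ideal in which the determinant can be adjusted.\<close>
  then have "jacobian_det f1 f2 - D * in_x (pderiv r) \<in> ideal2 f1 f2"
    using Jmod ideal2_subset by blast
  note J = this[unfolded D_def]
  obtain m0 l0 where b: "m0 * r + l0 * pderiv r = 1"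
    using bezout_no_common_root[of r "pderiv r"] DJ by (metis mult_zero_right)
  \<comment> \<open>Reducing \<open>l0\<close> modulo \<open>r\<close> secures the degree bound, and
    \<open>mu\<close> absorbs the quotient. For constant \<open>r\<close> this gives
    \<open>lam = 0\<close>.\<close>
  define lam where "lam = l0 mod r"
  define mu where "mu = m0 + pderiv r * (l0 div r)"
  have "r * mu + pderiv r * lam = m0 * r + (l0 div r * r + l0 mod r) * pderiv r"
    by (simp only: lam_def mu_def algebra_simps)
  then have bez: "r * mu + pderiv r * lam = 1" by (simp add: b)
  then have bez': "in_x r * in_x mu + in_x (pderiv r) * in_x lam = 1" by (metis in_x_simps)
  have deg: "degree lam \<le> degree r"
    using degree_mod_less[OF r0, of l0] by (auto simp: lam_def)
  obtain h1 h2 k1 k2 where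
    "f1 = h1 * in_x r - k2 * (var_y * in_x lam)" "f2 = h2 * in_x r + k1 * (var_y * in_x lam)"
    "h1 * k1 + k2 * h2 = jacobian_det f1 f2"
    using correct_determinant[OF f bez' J] by blast
  then show ?thesis
    using bez deg
    by (intro exI[of _ h1] exI[of _ h2] exI[of _ k1] exI[of _ k2] exI[of _ r] exI[of _ lam] exI[of _ mu])
      (simp add: vec_eq_iff forall_2 matrix_vector_mult_def sum_2 det_2)
qed

end
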